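(* Let $k\ge 2$, $n\ge 2$ and $n\ge m\ge 1$ be integers, and let $t=\left\lceil \frac{n-m+1}{k-1}\right\rceil$. Suppose that $t>m$ and $$nt>(t-m)(m-1)t+m\big((n-1)(k-1)+m\big).$$ (a) If $k$ is odd, then $r(S_n^m;k)=k(n-1)+m+2$. (b) If $k$ is even, then $\max\{k(n-1)+1,\ (k-1)(n-1)+2m+2\}\le r(S_n^m;k)\le k(n-1)+m+2$.
   Context: All graphs are finite, simple and undirected. For integers $n\ge2$ and $n\ge m\ge 1$, $S_n^m$ denotes the graph obtained from the star $K_{1,n}$ by subdividing $m$ of its edges, each exactly once. A $k$-edge-coloring of a graph $G$ is any function $\tau:E(G)\to\{1,\dots,k\}$ (not necessarily proper). For a graph $H$ and integer $k\ge1$, the $k$-color Ramsey number $r(H;k)$ is the smallest integer $N$ such that every $k$-edge-coloring of the complete graph $K_N$ contains a monochromatic copy of $H$ (as a not necessarily induced subgraph). *)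

theory Defs
  imports Complex_Main "HOL-Library.Ramsey"
begin

text \<open>
  A graph is a pair of a vertex set and an edge set. The edges of a simple undirected graph are
  2-element sets of vertices, so that they are elements of \<^term>\<open>[V]\<^bsup>2\<^esup>\<close> as in
  \<^theory>\<open>HOL-Library.Ramsey\<close>.
\<close>

type_synonym 'a graph = "'a set \<times> 'a set set"

abbreviation verts :: "'a graph \<Rightarrow> 'a set" where
  "verts \<equiv> fst"

abbreviation edges :: "'a graph \<Rightarrow> 'a set set" where
  "edges \<equiv> snd"

definition fin_simple_graph :: "'a graph \<Rightarrow> bool" where
  "fin_simple_graph G \<longleftrightarrow> finite (verts G) \<and> edges G \<subseteq> [verts G]\<^bsup>2\<^esup>"

definition complete_graph :: "nat \<Rightarrow> nat graph" where
  "complete_graph N = ({..<N}, [{..<N}]\<^bsup>2\<^esup>)"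

definition star :: "nat \<Rightarrow> nat graph" where
  "star n = ({0..n}, {{0, i} |i. i \<in> {1..n}})"

text \<open>
  Subdividing once each edge of \<open>G\<close> that lies in \<open>F\<close>: the old vertices are tagged with
  \<^const>\<open>Inl\<close>, and the new vertex placed on the edge \<open>e\<close> is \<^term>\<open>Inr e\<close>.
\<close>

definition subdivide :: "'a graph \<Rightarrow> 'a set set \<Rightarrow> ('a + 'a set) graph" where
  "subdivide G F =
     (Inl ` verts G \<union> Inr ` F,
      {Inl ` e |e. e \<in> edges G - F} \<union> {{Inl v, Inr e} |v e. e \<in> F \<and> v \<in> e})"

text \<open>
  All choices of \<open>m\<close> edges of the star give isomorphic graphs; the edges to the leaves
  \<open>1, \<dots>, m\<close> are chosen here.
\<close>

definition subdivided_star :: "nat \<Rightarrow> nat \<Rightarrow> (nat + nat set) graph" where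
  "subdivided_star n m = subdivide (star n) {{0, i} |i. i \<in> {1..m}}"

text \<open>A not necessarily induced copy of \<open>H\<close> in \<open>G\<close>.\<close>

definition contains_copy :: "'a graph \<Rightarrow> 'b graph \<Rightarrow> bool" where
  "contains_copy G H \<longleftrightarrow>
     (\<exists>f. inj_on f (verts H) \<and> f ` verts H \<subseteq> verts G \<and> (\<forall>e \<in> edges H. f ` e \<in> edges G))"

definition edge_coloring :: "nat \<Rightarrow> 'a graph \<Rightarrow> ('a set \<Rightarrow> nat) \<Rightarrow> bool" where
  "edge_coloring k G \<tau> \<longleftrightarrow> \<tau> \<in> edges G \<rightarrow> {1..k}"

definition color_class :: "'a graph \<Rightarrow> ('a set \<Rightarrow> nat) \<Rightarrow> nat \<Rightarrow> 'a graph" where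
  "color_class G \<tau> c = (verts G, {e \<in> edges G. \<tau> e = c})"

definition ramsey_arrows :: "nat \<Rightarrow> 'b graph \<Rightarrow> nat \<Rightarrow> bool" where
  "ramsey_arrows N H k \<longleftrightarrow>
     (\<forall>\<tau>. edge_coloring k (complete_graph N) \<tau> \<longrightarrow>
        (\<exists>c \<in> {1..k}. contains_copy (color_class (complete_graph N) \<tau> c) H))"

definition ramsey_number :: "'b graph \<Rightarrow> nat \<Rightarrow> nat" where
  "ramsey_number H k = (LEAST N. ramsey_arrows N H k)"

lemma fin_simple_graph_complete_graph: "fin_simple_graph (complete_graph N)"
  by (simp add: fin_simple_graph_def complete_graph_def)

lemma fin_simple_graph_star: "fin_simple_graph (star n)"
  by (auto simp: fin_simple_graph_def star_def)

lemma fin_simple_graph_subdivide: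
  assumes "fin_simple_graph G" "F \<subseteq> edges G"
  shows "fin_simple_graph (subdivide G F)"
proof -
  have "finite (edges G)"
    using assms(1) finite_imp_finite_nsets finite_subset unfolding fin_simple_graph_def by blast
  then have "finite F"
    using assms(2) finite_subset by blast
  moreover have "Inl ` e \<in> [Inl ` verts G \<union> Inr ` F]\<^bsup>2\<^esup>" if "e \<in> edges G" for e
  proof -
    have "e \<in> [verts G]\<^bsup>2\<^esup>"
      using that assms(1) unfolding fin_simple_graph_def by blast
    then obtain x y where "e = {x, y}" "x \<in> verts G" "y \<in> verts G" "x \<noteq> y"
      by (rule nsets2_E)
    then show ?thesis by simp
  qed
  moreover have "v \<in> verts G" if "e \<in> F" "v \<in> e" for v e
    using that assms unfolding fin_simple_graph_def nsets_def by blast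
  ultimately show ?thesis
    using assms(1) by (auto simp: fin_simple_graph_def subdivide_def)
qed

lemma fin_simple_graph_subdivided_star:
  assumes "m \<le> n"
  shows "fin_simple_graph (subdivided_star n m)"
  unfolding subdivided_star_def
proof (rule fin_simple_graph_subdivide[OF fin_simple_graph_star])
  show "{{0, i} |i. i \<in> {1..m}} \<subseteq> edges (star n)"
    using assms by (fastforce simp: star_def)
qed

text \<open>By Ramsey's theorem the minimum in \<^const>\<open>ramsey_number\<close> is attained.\<close>

lemma ramsey_arrows_exists:
  assumes "fin_simple_graph H" "k \<ge> 1"
  shows "\<exists>N. ramsey_arrows N H k"
proof -
  define q where "q = card (verts H)"
  obtain N :: nat where N: "partn_lst {..<N} (replicate k q) 2"
    using ramsey_full by blast
  have "ramsey_arrows N H k"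
    unfolding ramsey_arrows_def
  proof (intro allI impI)
    fix \<tau> assume "edge_coloring k (complete_graph N) \<tau>"
    then have \<tau>: "\<tau> e \<in> {1..k}" if "e \<in> [{..<N}]\<^bsup>2\<^esup>" for e
      using that by (auto simp: edge_coloring_def complete_graph_def)
    have "(\<lambda>e. \<tau> e - 1) \<in> [{..<N}]\<^bsup>2\<^esup> \<rightarrow> {..<length (replicate k q)}"
      using \<tau> by fastforce
    then obtain i where i: "i < k" "monochromatic {..<N} q 2 (\<lambda>e. \<tau> e - 1) i"
      using N unfolding partn_lst_def by fastforce
    then obtain K where K: "K \<subseteq> {..<N}" "finite K" "card K = q"
      and col: "\<And>e. e \<in> [K]\<^bsup>2\<^esup> \<Longrightarrow> \<tau> e - 1 = i"
      unfolding monochromatic_def nsets_def by (auto simp: image_subset_iff)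
    obtain f where f: "bij_betw f (verts H) K"
      using K assms(1) finite_same_card_bij unfolding fin_simple_graph_def q_def by metis
    have "f ` e \<in> edges (color_class (complete_graph N) \<tau> (Suc i))" if "e \<in> edges H" for e
    proof -
      have "e \<in> [verts H]\<^bsup>2\<^esup>"
        using that assms(1) unfolding fin_simple_graph_def by blast
      then obtain x y where e: "e = {x, y}" "x \<in> verts H" "y \<in> verts H" "x \<noteq> y"
        by (rule nsets2_E)
      then have fe: "f ` e \<in> [K]\<^bsup>2\<^esup>"
        using f by (auto simp: bij_betw_def inj_on_def)
      then have feN: "f ` e \<in> [{..<N}]\<^bsup>2\<^esup>"
        using K(1) nsets_mono by blast
      have "\<tau> (f ` e) \<ge> 1"
        using \<tau>[OF feN] by simp
      then have "\<tau> (f ` e) = Suc i"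
        using col[OF fe] by linarith
      then show ?thesis
        using feN by (simp add: color_class_def complete_graph_def)
    qed
    then have "contains_copy (color_class (complete_graph N) \<tau> (Suc i)) H"
      using f K(1) unfolding contains_copy_def
      by (intro exI[of _ f]) (auto simp: bij_betw_def color_class_def complete_graph_def)
    then show "\<exists>c \<in> {1..k}. contains_copy (color_class (complete_graph N) \<tau> c) H"
      using i(1) by (intro bexI[of _ "Suc i"]) auto
  qed
  then show ?thesis ..
qed

end

theory Submission
  imports Defs "HOL-Number_Theory.Cong"
begin

text \<open>
  A subdivided star in a graph is a centre \<open>v\<close>, a set \<open>X\<close> of \<open>n\<close> neighbours of \<open>v\<close>, and a
  matching of size \<open>m\<close> from \<open>X\<close> into the vertices outside \<open>X \<union> {v}\<close>.

  \<^bold>\<open>Upper bound.\<close> Let \<open>N = k (n - 1) + m + 2\<close>, and suppose that no colour contains the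
  subdivided star. Some colour \<open>c\<close> has degree at least \<open>n\<close> at a vertex \<open>v\<close>; take \<open>n\<close> of the
  \<open>c\<close>-neighbours as \<open>X\<close>, and let \<open>Y\<close> be the remaining \<open>(k - 1) (n - 1) + m\<close> vertices. There is no
  \<open>c\<close>-matching of size \<open>m\<close> from \<open>X\<close> to \<open>Y\<close>, so a maximal matching shows that, after fewer than \<open>m\<close>
  vertices are removed on either side, no edge between \<open>X\<close> and \<open>Y\<close> has colour \<open>c\<close>
  (\<open>matching_or_cover\<close>). Each remaining \<open>x \<in> X\<close> then sends at least \<open>(k - 1) (n - 1) + 1\<close> edges in
  only \<open>k - 1\<close> colours to \<open>Y\<close>, so it has \<open>n\<close> neighbours in \<open>Y\<close> in one of these colours. At least
  \<open>n - m + 1\<close> vertices \<open>x\<close> remain, hence \<open>t\<close> of them, forming a set \<open>T\<close>, share such a colour \<open>d\<close>.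
  Now the \<open>d\<close>-coloured edges between \<open>T\<close> and \<open>Y\<close> are counted. There are at least \<open>n t\<close>. On the
  other hand, few \<open>y \<in> Y\<close> have more than \<open>m\<close> neighbours in \<open>T\<close>: if \<open>x \<in> T\<close> had \<open>m\<close> such
  neighbours, they could be matched greedily to \<open>m\<close> other vertices of \<open>T\<close>, which gives a
  subdivided star with centre \<open>x\<close>. So there are at most \<open>(m - 1) t\<close> such \<open>y\<close>, and the count is at
  most \<open>m |Y| + (t - m) (m - 1) t\<close> (\<open>double_counting_bound\<close>), against the hypothesis.

  \<^bold>\<open>Lower bounds.\<close> On \<open>k (n - 1)\<close> vertices, colouring \<open>{u, w}\<close> with \<open>u + w\<close> modulo \<open>k\<close> keeps all
  degrees below \<open>n\<close>. For odd \<open>k\<close> one can add a set \<open>I\<close> of \<open>m + 1\<close> vertices and colour all edges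
  from \<open>u\<close> to \<open>I\<close> with \<open>2 u\<close>. As \<open>2\<close> is invertible modulo \<open>k\<close>, the vertices \<open>u\<close> with \<open>2 u\<close> equal to a
  given colour form one residue class; together with \<open>I\<close> this class makes up \<open>n + m\<close> vertices
  that no edge of that colour leaves, too few for the \<open>n + m + 1\<close> vertices of the subdivided star,
  and all other vertices still have degree \<open>n - 1\<close>. For even \<open>k\<close>, take this colouring
  for \<open>k - 1\<close> colours, and add \<open>m\<close> vertices whose edges all get a new colour: these \<open>m\<close>
  vertices meet every edge of the new colour, but the subdivided star with \<open>m < n\<close> has \<open>m + 1\<close>
  pairwise disjoint edges.
\<close>

section \<open>Copies of a subdivided star\<close>

text \<open>
  The legs are indexed from \<open>1\<close>: \<open>h i\<close> is the neighbour of the centre \<open>v\<close> on leg \<open>i\<close>, and for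
  \<open>i \<le> m\<close> the leg goes on to \<open>g i\<close>. In terms of the subdivision, \<open>h i\<close> is the new vertex on
  the edge \<open>{0, i}\<close> when \<open>i \<le> m\<close>, and the leaf \<open>i\<close> itself when \<open>i > m\<close>.
\<close>

definition is_spider :: "'a graph \<Rightarrow> nat \<Rightarrow> nat \<Rightarrow> 'a \<Rightarrow> (nat \<Rightarrow> 'a) \<Rightarrow> (nat \<Rightarrow> 'a) \<Rightarrow> bool" where
  "is_spider G n m v h g \<longleftrightarrow>
     inj_on h {1..n} \<and> inj_on g {1..m} \<and>
     v \<notin> h ` {1..n} \<and> v \<notin> g ` {1..m} \<and> h ` {1..n} \<inter> g ` {1..m} = {} \<and>
     {v} \<union> h ` {1..n} \<union> g ` {1..m} \<subseteq> verts G \<and>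
     (\<forall>i \<in> {1..n}. {v, h i} \<in> edges G) \<and> (\<forall>i \<in> {1..m}. {h i, g i} \<in> edges G)"

lemma verts_subdivided_star:
  "verts (subdivided_star n m) = Inl ` {0..n} \<union> (\<lambda>i. Inr {0, i}) ` {1..m}"
  by (simp add: subdivided_star_def subdivide_def star_def setcompr_eq_image image_image
      atLeastAtMost_def atLeast_def atMost_def Int_def)

lemma edges_subdivided_star:
  assumes "m \<le> n"
  shows "edges (subdivided_star n m) =
    (\<lambda>i. {Inl 0, Inl i}) ` {m<..n} \<union> (\<lambda>i. {Inl 0, Inr {0, i}}) ` {1..m}
      \<union> (\<lambda>i. {Inl i, Inr {0, i}}) ` {1..m}"
proof -
  have *: "{{0, i} |i. i \<in> {1..n}} - {{0, i} |i. i \<in> {1..m}} = (\<lambda>i::nat. {0, i}) ` {m<..n}"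
    by (fastforce simp: doubleton_eq_iff)
  have "edges (subdivided_star n m) =
     {Inl ` e |e. e \<in> (\<lambda>i::nat. {0, i}) ` {m<..n}}
       \<union> {{Inl v, Inr e} |v e. e \<in> {{0, i} |i. i \<in> {1..m}} \<and> v \<in> e}"
    unfolding subdivided_star_def subdivide_def star_def using * by simp
  also have "{Inl ` e |e. e \<in> (\<lambda>i::nat. {0, i}) ` {m<..n}}
      = (\<lambda>i. {Inl 0, Inl i}) ` {m<..n}"
    by (auto simp: setcompr_eq_image image_image
      atLeastAtMost_def atLeast_def atMost_def Int_def)
  also have "{{Inl v, Inr e} |v e. e \<in> {{0, i} |i. i \<in> {1..m}} \<and> v \<in> e}
     = (\<lambda>i. {Inl 0, Inr {0, i}}) ` {1..m} \<union> (\<lambda>i. {Inl i, Inr {0::nat, i}}) ` {1..m}"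
    by blast
  finally show ?thesis by (simp add: Un_assoc)
qed

lemma contains_copy_iff_spider:
  assumes "m \<le> n"
  shows "contains_copy G (subdivided_star n m) \<longleftrightarrow> (\<exists>v h g. is_spider G n m v h g)"
proof
  assume "contains_copy G (subdivided_star n m)"
  then obtain f where inj: "inj_on f (verts (subdivided_star n m))"
    and sub: "f ` verts (subdivided_star n m) \<subseteq> verts G"
    and edge: "\<And>e. e \<in> edges (subdivided_star n m) \<Longrightarrow> f ` e \<in> edges G"
    unfolding contains_copy_def by blast
  define h where "h i = (if i \<le> m then f (Inr {0, i}) else f (Inl i))" for i
  define g where "g i = f (Inl i)" for i
  have feq: "f x = f y \<longleftrightarrow> x = y"
    if "x \<in> verts (subdivided_star n m)" "y \<in> verts (subdivided_star n m)" for x y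
    using inj that by (auto dest: inj_onD)
  have L: "Inl i \<in> verts (subdivided_star n m)" if "i \<le> n" for i
    using that by (auto simp: verts_subdivided_star)
  have R: "Inr {0, i} \<in> verts (subdivided_star n m)" if "1 \<le> i" "i \<le> m" for i
    using that by (auto simp: verts_subdivided_star)
  have "inj_on h {1..n}"
    by (rule inj_onI) (auto simp: h_def feq L R doubleton_eq_iff split: if_splits)
  moreover have "inj_on g {1..m}"
    using assms by (intro inj_onI) (auto simp: g_def feq L)
  moreover have "f (Inl 0) \<notin> h ` {1..n}"
    by (auto simp: h_def feq L R split: if_splits)
  moreover have "f (Inl 0) \<notin> g ` {1..m}"
    using assms by (auto simp: g_def feq L)
  moreover have "h ` {1..n} \<inter> g ` {1..m} = {}"
    using assms by (auto simp: g_def h_def feq L R split: if_splits)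
  moreover have "{f (Inl 0)} \<union> h ` {1..n} \<union> g ` {1..m} \<subseteq> verts G"
    using assms sub L R by (auto simp: g_def h_def)
  moreover have "{f (Inl 0), h i} \<in> edges G" if "i \<in> {1..n}" for i
  proof (cases "i \<le> m")
    case True
    then have "{Inl 0, Inr {0, i}} \<in> edges (subdivided_star n m)"
      using that by (auto simp: edges_subdivided_star[OF assms])
    from edge[OF this] True show ?thesis by (simp add: h_def)
  next
    case False
    then have "{Inl 0, Inl i} \<in> edges (subdivided_star n m)"
      using that by (auto simp: edges_subdivided_star[OF assms])
    from edge[OF this] False show ?thesis by (simp add: h_def)
  qed
  moreover have "{h i, g i} \<in> edges G" if "i \<in> {1..m}" for i
  proof -
    have "{Inl i, Inr {0, i}} \<in> edges (subdivided_star n m)"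
      using that by (auto simp: edges_subdivided_star[OF assms])
    from edge[OF this] that show ?thesis by (simp add: h_def g_def insert_commute)
  qed
  ultimately have "is_spider G n m (f (Inl 0)) h g"
    unfolding is_spider_def by blast
  then show "\<exists>v h g. is_spider G n m v h g" by blast
next
  assume "\<exists>v h g. is_spider G n m v h g"
  then obtain v h g where s: "is_spider G n m v h g" by blast
  \<comment> \<open>\<open>Max\<close> recovers the index \<open>i\<close> from the subdivided edge \<open>{0, i}\<close>.\<close>
  define f where "f = case_sum (\<lambda>j. if j = 0 then v else if j \<le> m then g j else h j)
    (\<lambda>e. h (Max e))"
  have [simp]: "f (Inl j) = (if j = 0 then v else if j \<le> m then g j else h j)" for j
    by (simp add: f_def)
  have [simp]: "f (Inr {0, j}) = h j" for j
    by (simp add: f_def)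
  have hh: "h i = h j \<longleftrightarrow> i = j" if "1 \<le> i" "i \<le> n" "1 \<le> j" "j \<le> n" for i j
    using s that unfolding is_spider_def by (auto dest: inj_onD)
  have gg: "g i = g j \<longleftrightarrow> i = j" if "1 \<le> i" "i \<le> m" "1 \<le> j" "j \<le> m" for i j
    using s that unfolding is_spider_def by (auto dest: inj_onD)
  have hg: "h i \<noteq> g j" if "1 \<le> i" "i \<le> n" "1 \<le> j" "j \<le> m" for i j
    using s that unfolding is_spider_def disjoint_iff by (metis atLeastAtMost_iff imageI)
  have vh: "v \<noteq> h i" if "1 \<le> i" "i \<le> n" for i
    using s that unfolding is_spider_def by auto
  have vg: "v \<noteq> g i" if "1 \<le> i" "i \<le> m" for i
    using s that unfolding is_spider_def by auto
  have gh: "{g i, h i} \<in> edges G" if "1 \<le> i" "i \<le> m" for i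
    using s that insert_commute[of "g i" "h i"] unfolding is_spider_def by simp
  have "inj_on f (verts (subdivided_star n m))"
    unfolding verts_subdivided_star using assms
    by (intro inj_onI)
       (auto split: if_splits simp: hh gg hg hg[symmetric] vh vh[symmetric] vg vg[symmetric])
  moreover have "f ` verts (subdivided_star n m) \<subseteq> verts G"
    unfolding verts_subdivided_star using assms s by (auto simp: is_spider_def image_subset_iff)
  moreover have "f ` e \<in> edges G" if "e \<in> edges (subdivided_star n m)" for e
    using that assms s unfolding edges_subdivided_star[OF assms]
    by (auto simp: is_spider_def gh)
  ultimately show "contains_copy G (subdivided_star n m)"
    unfolding contains_copy_def by blast
qed

text \<open>
  The form in which copies are found: the neighbours of the centre come as a set that may
  be larger than necessary, as long as the matched ones are among them and the ends of the
  matching avoid all of it.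
\<close>

lemma contains_copy_subdivided_starI:
  assumes "v \<in> verts G" "finite X" "X \<subseteq> verts G" "n \<le> card X" "v \<notin> X"
    and "M \<subseteq> X" "card M = m" "m \<le> n"
    and g: "inj_on g M" "g ` M \<subseteq> verts G" "g ` M \<inter> X = {}" "v \<notin> g ` M"
    and "\<And>x. x \<in> X \<Longrightarrow> {v, x} \<in> edges G"
    and "\<And>x. x \<in> M \<Longrightarrow> {x, g x} \<in> edges G"
  shows "contains_copy G (subdivided_star n m)"
proof -
  obtain X' where X': "M \<subseteq> X'" "X' \<subseteq> X" "card X' = n"
    using exists_subset_between[OF _ assms(4,6,2)] assms(7,8) by auto
  have fin: "finite X'" "finite M"
    using finite_subset[OF X'(2) assms(2)] finite_subset[OF assms(6,2)] by auto
  obtain p where p: "bij_betw p {1..m} M"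
    using ex_bij_betw_nat_finite_1[OF fin(2)] unfolding assms(7) ..
  have "card {m<..n} = card (X' - M)"
    using X' fin assms(7) by (simp add: card_Diff_subset)
  then obtain q where q: "bij_betw q {m<..n} (X' - M)"
    using finite_same_card_bij[OF finite_greaterThanAtMost finite_Diff[OF fin(1)]] by blast
  define h where "h i = (if i \<le> m then p i else q i)" for i
  have hM: "bij_betw h {1..m} M"
    using p bij_betw_cong[of "{1..m}" h p] by (simp add: h_def)
  have "bij_betw h {m<..n} (X' - M)"
    using q bij_betw_cong[of "{m<..n}" h q] by (simp add: h_def)
  with hM have "bij_betw h ({1..m} \<union> {m<..n}) (M \<union> (X' - M))"
    by (rule bij_betw_combine) blast
  moreover have "{1..m} \<union> {m<..n} = {1..n}"
    using assms(8) by auto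
  moreover have "M \<union> (X' - M) = X'"
    using X'(1) by blast
  ultimately have hX: "bij_betw h {1..n} X'" by simp
  then have hin: "h i \<in> X" if "i \<in> {1..n}" for i
    using that X'(2) by (auto simp: bij_betw_def)
  have hinM: "h i \<in> M" if "i \<in> {1..m}" for i
    using that hM by (auto simp: bij_betw_def)
  have "is_spider G n m v h (g \<circ> h)"
    unfolding is_spider_def
  proof (intro conjI)
    show "inj_on h {1..n}" using hX by (simp add: bij_betw_def)
    show "inj_on (g \<circ> h) {1..m}"
      using hM g(1) by (simp add: bij_betw_def comp_inj_on)
    show "v \<notin> h ` {1..n}" using hin assms(5) by auto
    show "v \<notin> (g \<circ> h) ` {1..m}" using hinM g(4) by auto
    show "h ` {1..n} \<inter> (g \<circ> h) ` {1..m} = {}"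
      using hin hinM g(3) by (fastforce simp: disjoint_iff)
    show "{v} \<union> h ` {1..n} \<union> (g \<circ> h) ` {1..m} \<subseteq> verts G"
      using hin hinM g(2) assms(1,3) by auto
    show "\<forall>i\<in>{1..n}. {v, h i} \<in> edges G" using hin assms(13) by blast
    show "\<forall>i\<in>{1..m}. {h i, (g \<circ> h) i} \<in> edges G"
      using hinM assms(14) by auto
  qed
  then show ?thesis
    by (auto simp: contains_copy_iff_spider[OF assms(8)])
qed

text \<open>
  The two obstructions to a centre \<open>v\<close> in the colourings by residues below: too small a degree, or a
  union of components around \<open>v\<close> that is too small to hold the connected subdivided star.
\<close>

lemma not_contains_copy_subdivided_star:
  assumes "m \<le> n" "n \<ge> 1" "finite (verts G)"
    and "\<And>v. v \<in> verts G \<Longrightarrow>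
      card {w \<in> verts G. {v, w} \<in> edges G} < n \<or>
      (\<exists>D. finite D \<and> v \<in> D \<and> card D \<le> n + m \<and>
         (\<forall>x y. x \<in> D \<longrightarrow> {x, y} \<in> edges G \<longrightarrow> y \<in> D))"
  shows "\<not> contains_copy G (subdivided_star n m)"
proof
  assume "contains_copy G (subdivided_star n m)"
  then obtain v h g where s: "is_spider G n m v h g"
    by (auto simp: contains_copy_iff_spider[OF assms(1)])
  then have "v \<in> verts G" by (simp add: is_spider_def)
  from assms(4)[OF this] show False
  proof (elim disjE exE conjE)
    have "card (h ` {1..n}) \<le> card {w \<in> verts G. {v, w} \<in> edges G}"
      using s assms(3) by (intro card_mono) (auto simp: is_spider_def)
    moreover have "card (h ` {1..n}) = n"
      using s by (simp add: is_spider_def card_image)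
    moreover assume "card {w \<in> verts G. {v, w} \<in> edges G} < n"
    ultimately show False by simp
  next
    fix D assume D: "finite D" "v \<in> D" "card D \<le> n + m"
      "\<forall>x y. x \<in> D \<longrightarrow> {x, y} \<in> edges G \<longrightarrow> y \<in> D"
    have h: "h ` {1..n} \<subseteq> D"
      using s D by (auto simp: is_spider_def)
    moreover have "g ` {1..m} \<subseteq> D"
    proof
      fix y assume "y \<in> g ` {1..m}"
      then obtain i where "i \<in> {1..m}" "y = g i" by blast
      then have "h i \<in> D" "{h i, y} \<in> edges G"
        using s h assms(1) by (auto simp: is_spider_def)
      then show "y \<in> D"
        using D(4) by blast
    qed
    ultimately have "card ({v} \<union> (h ` {1..n} \<union> g ` {1..m})) \<le> card D"
      using D by (intro card_mono) auto
    also have "card ({v} \<union> (h ` {1..n} \<union> g ` {1..m})) = 1 + (n + m)"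
      using s by (subst card_Un_disjoint; (subst card_Un_disjoint)?)
        (auto simp: is_spider_def card_image)
    finally show False using D(3) by simp
  qed
qed

section \<open>Colorings without a monochromatic subdivided star\<close>

lemma edges_complete_graph: "{u, w} \<in> edges (complete_graph N) \<longleftrightarrow> u < N \<and> w < N \<and> u \<noteq> w"
  by (auto simp: complete_graph_def)

lemma verts_complete_graph [simp]: "verts (complete_graph N) = {..<N}"
  by (simp add: complete_graph_def)

lemma verts_color_class [simp]: "verts (color_class G \<tau> c) = verts G"
  by (simp add: color_class_def)

lemma edges_color_class: "e \<in> edges (color_class G \<tau> c) \<longleftrightarrow> e \<in> edges G \<and> \<tau> e = c"
  by (simp add: color_class_def)

lemma contains_copy_mono:
  assumes "contains_copy G H" "verts G \<subseteq> verts G'" "edges G \<subseteq> edges G'"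
  shows "contains_copy G' H"
proof -
  from assms(1) obtain f where "inj_on f (verts H)" "f ` verts H \<subseteq> verts G"
    "\<forall>e \<in> edges H. f ` e \<in> edges G"
    unfolding contains_copy_def by (elim exE conjE)
  then show ?thesis
    using assms(2,3) unfolding contains_copy_def by (intro exI[of _ f]) auto
qed

lemma ramsey_arrows_mono:
  assumes "ramsey_arrows N H k" "N \<le> N'"
  shows "ramsey_arrows N' H k"
  unfolding ramsey_arrows_def
proof (intro allI impI)
  fix \<tau> assume \<tau>: "edge_coloring k (complete_graph N') \<tau>"
  have sub: "edges (complete_graph N) \<subseteq> edges (complete_graph N')"
    using assms(2) by (simp add: complete_graph_def nsets_mono)
  then have "edge_coloring k (complete_graph N) \<tau>"
    using \<tau> by (auto simp: edge_coloring_def)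
  then obtain c where c: "c \<in> {1..k}" "contains_copy (color_class (complete_graph N) \<tau> c) H"
    using assms(1) unfolding ramsey_arrows_def by blast
  have "contains_copy (color_class (complete_graph N') \<tau> c) H"
    by (rule contains_copy_mono[OF c(2)])
       (use assms(2) sub in \<open>auto simp: color_class_def complete_graph_def\<close>)
  with c(1) show "\<exists>c\<in>{1..k}. contains_copy (color_class (complete_graph N') \<tau> c) H" ..
qed

lemma card_congruent_le:
  fixes k q :: nat
  assumes "S \<subseteq> {..<k * q}" "\<And>x y. x \<in> S \<Longrightarrow> y \<in> S \<Longrightarrow> x mod k = y mod k"
  shows "card S \<le> q"
proof -
  have "inj_on (\<lambda>x. x div k) S"
    using assms(2) by (intro inj_onI) (metis div_mult_mod_eq)
  moreover have "(\<lambda>x. x div k) ` S \<subseteq> {..<q}"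
    using assms(1) by (auto simp: less_mult_imp_div_less mult.commute)
  ultimately show ?thesis
    using card_inj_on_le[of "\<lambda>x. x div k" S "{..<q}"] by simp
qed

lemma card_residue_le:
  fixes k q :: nat
  shows "card {w. w < k * q \<and> (u + w) mod k = r} \<le> q"
proof (rule card_congruent_le[where k = k])
  fix x y assume "x \<in> {w. w < k * q \<and> (u + w) mod k = r}" "y \<in> {w. w < k * q \<and> (u + w) mod k = r}"
  then have "[u + x = u + y] (mod k)" by (simp add: cong_def)
  then show "x mod k = y mod k"
    using cong_add_lcancel_nat cong_def by blast
qed auto

text \<open>
  An edge between vertices \<open>u\<close> and \<open>w\<close> below \<open>M\<close> gets the colour \<open>u + w\<close> modulo \<open>k\<close>. All edges from \<open>u < M\<close> to
  vertices beyond \<open>M\<close> get the colour \<open>2 u\<close>, as if they led to a copy of \<open>u\<close>.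
  The shift by one makes the colours start at \<open>1\<close>.
\<close>

definition sum_coloring :: "nat \<Rightarrow> nat \<Rightarrow> nat set \<Rightarrow> nat" where
  "sum_coloring k M e = (Min e + (if Max e < M then Max e else Min e)) mod k + 1"

lemma edge_coloring_sum_coloring:
  assumes "k \<ge> 1"
  shows "edge_coloring k G (sum_coloring k M)"
proof -
  have "a mod k + 1 \<in> {1..k}" for a
    using assms mod_less_divisor[of k a] by (auto simp: Suc_le_eq)
  then show ?thesis
    by (auto simp: edge_coloring_def sum_coloring_def)
qed

lemma sum_coloring_lower:
  "\<lbrakk>u < M; w < M\<rbrakk> \<Longrightarrow> sum_coloring k M {u, w} = (u + w) mod k + 1"
  by (cases u w rule: linorder_cases) (auto simp: sum_coloring_def min_def max_def add.commute)

lemma sum_coloring_mixed: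
  "\<lbrakk>u < M; M \<le> w\<rbrakk> \<Longrightarrow> sum_coloring k M {u, w} = (2 * u) mod k + 1"
  by (auto simp: sum_coloring_def min_def max_def mult_2)

lemma not_ramsey_arrows_regular:
  assumes "k \<ge> 1" "n \<ge> 1" "m \<le> n"
  shows "\<not> ramsey_arrows (k * (n - 1)) (subdivided_star n m) k"
proof
  define M where "M = k * (n - 1)"
  define \<tau> where "\<tau> = sum_coloring k M"
  assume "ramsey_arrows (k * (n - 1)) (subdivided_star n m) k"
  then obtain c where c: "contains_copy (color_class (complete_graph M) \<tau> c) (subdivided_star n m)"
    using edge_coloring_sum_coloring[OF assms(1)] unfolding ramsey_arrows_def M_def \<tau>_def by blast
  have "\<not> contains_copy (color_class (complete_graph M) \<tau> c) (subdivided_star n m)"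
  proof (rule not_contains_copy_subdivided_star[OF assms(3,2)], goal_cases)
    case (2 v)
    have "card {w \<in> {..<M}. {v, w} \<in> edges (color_class (complete_graph M) \<tau> c)}
      \<le> card {w. w < k * (n - 1) \<and> (v + w) mod k = c - 1}"
      using 2 by (intro card_mono)
        (auto simp: edges_color_class edges_complete_graph \<tau>_def sum_coloring_lower M_def)
    also have "\<dots> \<le> n - 1" by (rule card_residue_le)
    finally show ?case using assms(2) by (intro disjI1) simp
  qed simp
  then show False using c by blast
qed

text \<open>
  In each colour, the vertices \<open>u < M\<close> with \<open>2 u\<close> equal to that colour form, together with all vertices
  beyond \<open>M\<close>, a set \<open>D\<close> that no edge of the colour leaves: for \<open>x, y < M\<close> an edge of colour
  \<open>2 x = x + y\<close> has \<open>x = y\<close> modulo \<open>k\<close>. That \<open>k\<close> is odd makes \<open>D\<close> small, since doubling is then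
  injective on residues.
\<close>

lemma not_ramsey_arrows_odd:
  assumes "odd k" "n \<ge> 1" "m \<le> n"
  shows "\<not> ramsey_arrows (k * (n - 1) + m + 1) (subdivided_star n m) k"
proof
  define M where "M = k * (n - 1)"
  define N where "N = M + m + 1"
  define \<tau> where "\<tau> = sum_coloring k M"
  assume arr: "ramsey_arrows (k * (n - 1) + m + 1) (subdivided_star n m) k"
  have "k \<ge> 1" using assms(1) by (cases k) auto
  then obtain c where c: "contains_copy (color_class (complete_graph N) \<tau> c) (subdivided_star n m)"
    using edge_coloring_sum_coloring arr unfolding ramsey_arrows_def N_def M_def \<tau>_def by blast
  define E where "E = {w. w < M \<and> (2 * w) mod k + 1 = c}"
  define D where "D = E \<union> {M..<N}"
  have "card E \<le> n - 1"
  proof (rule card_congruent_le[where k = k])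
    show "E \<subseteq> {..<k * (n - 1)}" by (auto simp: E_def M_def)
    fix x y assume "x \<in> E" "y \<in> E"
    then have "[2 * x = 2 * y] (mod k)" by (auto simp: E_def cong_def)
    moreover have "coprime 2 k" using assms(1) by simp
    ultimately show "x mod k = y mod k"
      using cong_mult_lcancel_nat cong_def by blast
  qed
  then have cardD: "card D \<le> n + m"
    using card_Un_le[of E "{M..<N}"] assms(2) by (simp add: D_def N_def)
  have closed: "y \<in> D" if "x \<in> D" and e: "{x, y} \<in> edges (color_class (complete_graph N) \<tau> c)" for x y
  proof (cases "y < M")
    case False
    then show ?thesis using e by (simp add: D_def edges_color_class edges_complete_graph)
  next
    case y: True
    have c: "\<tau> {x, y} = c" using e by (simp add: edges_color_class)
    show ?thesis
    proof (cases "x < M")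
      case False
      then have "(2 * y) mod k + 1 = c"
        using c y sum_coloring_mixed[of y M x k] by (simp add: \<tau>_def insert_commute)
      then show ?thesis using y by (simp add: D_def E_def)
    next
      case True
      then have "(2 * x) mod k + 1 = c" using that(1) by (simp add: D_def E_def)
      moreover have "(x + y) mod k + 1 = c"
        using c y True by (simp add: \<tau>_def sum_coloring_lower)
      ultimately have *: "[x + x = x + y] (mod k)" by (simp add: cong_def mult_2)
      then have "[x = y] (mod k)" using cong_add_lcancel_nat by blast
      then have "[x + y = y + y] (mod k)" using cong_add_rcancel_nat by blast
      then have "(2 * y) mod k + 1 = c"
        using \<open>(x + y) mod k + 1 = c\<close> by (simp add: cong_def mult_2)
      then show ?thesis using y by (simp add: D_def E_def)
    qed
  qed
  have "\<not> contains_copy (color_class (complete_graph N) \<tau> c) (subdivided_star n m)"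
  proof (rule not_contains_copy_subdivided_star[OF assms(3,2)], goal_cases)
    case (2 v)
    show ?case
    proof (cases "v \<in> D")
      case True
      then show ?thesis using cardD closed
        by (intro disjI2 exI[of _ D]) (auto simp: D_def E_def)
    next
      case False
      then have v: "v < M" using 2 by (auto simp: D_def)
      have "{w \<in> {..<N}. {v, w} \<in> edges (color_class (complete_graph N) \<tau> c)}
         \<subseteq> {w. w < k * (n - 1) \<and> (v + w) mod k = c - 1}"
      proof
        fix w assume "w \<in> {w \<in> {..<N}. {v, w} \<in> edges (color_class (complete_graph N) \<tau> c)}"
        then have w: "\<tau> {v, w} = c" by (simp add: edges_color_class)
        have "w < M"
        proof (rule ccontr)
          assume "\<not> w < M"
          then have "(2 * v) mod k + 1 = c"
            using w v by (simp add: \<tau>_def sum_coloring_mixed)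
          then show False using False v by (simp add: D_def E_def)
        qed
        then show "w \<in> {w. w < k * (n - 1) \<and> (v + w) mod k = c - 1}"
          using w v by (auto simp: \<tau>_def sum_coloring_lower M_def)
      qed
      then have "card {w \<in> {..<N}. {v, w} \<in> edges (color_class (complete_graph N) \<tau> c)}
        \<le> card {w. w < k * (n - 1) \<and> (v + w) mod k = c - 1}"
        by (intro card_mono) auto
      also have "\<dots> \<le> n - 1" by (rule card_residue_le)
      finally show ?thesis using assms(2) by (intro disjI1) simp
    qed
  qed simp
  then show False using c by blast
qed

text \<open>
  The \<open>m\<close> added vertices cover all edges of the new colour, while the subdivided star with
  \<open>m < n\<close> contains \<open>m + 1\<close> pairwise disjoint edges: the outer edges of the \<open>m\<close> long legs, and one
  short leg.
\<close>

lemma not_ramsey_arrows_Suc_color: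
  assumes "\<not> ramsey_arrows N (subdivided_star n m) k" "m < n"
  shows "\<not> ramsey_arrows (N + m) (subdivided_star n m) (k + 1)"
proof
  assume arr: "ramsey_arrows (N + m) (subdivided_star n m) (k + 1)"
  have mn: "m \<le> n" using assms(2) by simp
  obtain \<tau> where \<tau>: "edge_coloring k (complete_graph N) \<tau>"
    and no: "\<And>c. c \<in> {1..k} \<Longrightarrow>
      \<not> contains_copy (color_class (complete_graph N) \<tau> c) (subdivided_star n m)"
    using assms(1) unfolding ramsey_arrows_def by blast
  define \<tau>' where "\<tau>' e = (if e \<subseteq> {..<N} then \<tau> e else k + 1)" for e
  have old: "e \<in> edges (complete_graph N)" if "e \<in> edges (complete_graph (N + m))" "e \<subseteq> {..<N}" for e
    using that by (auto simp: complete_graph_def nsets_def)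
  have "edge_coloring (k + 1) (complete_graph (N + m)) \<tau>'"
    unfolding edge_coloring_def
  proof
    fix e assume "e \<in> edges (complete_graph (N + m))"
    then have "\<tau> e \<in> {1..k}" if "e \<subseteq> {..<N}"
      using \<tau> old that unfolding edge_coloring_def by blast
    then show "\<tau>' e \<in> {1..k + 1}"
      by (auto simp: \<tau>'_def)
  qed
  then obtain c where c: "c \<in> {1..k + 1}"
    and "contains_copy (color_class (complete_graph (N + m)) \<tau>' c) (subdivided_star n m)"
    using arr unfolding ramsey_arrows_def by blast
  then obtain v h g where s: "is_spider (color_class (complete_graph (N + m)) \<tau>' c) n m v h g"
    by (auto simp: contains_copy_iff_spider[OF mn])
  show False
  proof (cases "c = k + 1")
    case False
    have edge: "e \<in> edges (color_class (complete_graph N) \<tau> c) \<and> e \<subseteq> {..<N}"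
      if "e \<in> edges (color_class (complete_graph (N + m)) \<tau>' c)" for e
      using that False old by (auto simp: edges_color_class \<tau>'_def split: if_splits)
    have vh: "{v, h i} \<in> edges (color_class (complete_graph N) \<tau> c) \<and> {v, h i} \<subseteq> {..<N}"
      if "i \<in> {1..n}" for i
      by (rule edge) (use that s in \<open>simp add: is_spider_def\<close>)
    have hg: "{h i, g i} \<in> edges (color_class (complete_graph N) \<tau> c) \<and> {h i, g i} \<subseteq> {..<N}"
      if "i \<in> {1..m}" for i
      by (rule edge) (use that s in \<open>simp add: is_spider_def\<close>)
    have "n \<in> {1..n}" using assms(2) by simp
    then have "v < N" using vh by blast
    then have "is_spider (color_class (complete_graph N) \<tau> c) n m v h g"
      using s vh hg unfolding is_spider_def by auto
    moreover have "c \<in> {1..k}" using c False by simp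
    ultimately show False
      using no[of c] by (auto simp: contains_copy_iff_spider[OF mn])
  next
    case True
    define e where "e i = (if i \<le> m then {h i, g i} else {v, h n})" for i
    have new: "\<exists>z \<in> e i. z \<in> {N..<N + m}" if "i \<in> {1..m + 1}" for i
    proof -
      have "e i \<in> edges (color_class (complete_graph (N + m)) \<tau>' c)"
        using s that assms(2) by (auto simp: is_spider_def e_def)
      then have ei: "e i \<in> edges (complete_graph (N + m))" "\<tau>' (e i) = k + 1"
        using True by (auto simp: edges_color_class)
      have "\<not> e i \<subseteq> {..<N}"
      proof
        assume sub: "e i \<subseteq> {..<N}"
        then have "\<tau> (e i) \<in> {1..k}"
          using \<tau> old[OF ei(1)] unfolding edge_coloring_def by blast
        then show False using ei(2) sub by (simp add: \<tau>'_def)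
      qed
      moreover have "e i \<subseteq> {..<N + m}"
        using ei(1) by (simp add: complete_graph_def nsets_def)
      ultimately show ?thesis by fastforce
    qed
    then obtain z where z: "\<And>i. i \<in> {1..m + 1} \<Longrightarrow> z i \<in> e i \<and> z i \<in> {N..<N + m}"
      by metis
    have disj: "i = j" if "i \<in> {1..m + 1}" "j \<in> {1..m + 1}" "x \<in> e i" "x \<in> e j" for i j x
    proof -
      have hh: "h a = h b \<longleftrightarrow> a = b" if "a \<in> {1..n}" "b \<in> {1..n}" for a b
        using s that unfolding is_spider_def by (meson inj_on_eq_iff)
      have gg: "g a = g b \<longleftrightarrow> a = b" if "a \<in> {1..m}" "b \<in> {1..m}" for a b
        using s that unfolding is_spider_def by (meson inj_on_eq_iff)
      have hg: "h a \<noteq> g b" if "a \<in> {1..n}" "b \<in> {1..m}" for a b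
        using s that unfolding is_spider_def disjoint_iff by (metis imageI)
      have vh: "v \<noteq> h a" if "a \<in> {1..n}" for a
        using s that unfolding is_spider_def by auto
      have vg: "v \<noteq> g a" if "a \<in> {1..m}" for a
        using s that unfolding is_spider_def by auto
      have nin: "n \<in> {1..n}" using assms(2) by simp
      have spine: "a \<in> {1..n} \<and> a \<in> {1..m} \<and> a \<noteq> n" if "a \<le> m" "a \<in> {1..m + 1}" for a
        using that assms(2) by auto
      have leg: "{h a, g a} \<inter> {v, h n} = {}" if "a \<le> m" "a \<in> {1..m + 1}" for a
        using spine[OF that] vh[of a] vg[of a] hh[OF _ nin, of a] hg[OF nin, of a] by auto
      show ?thesis
      proof (cases "i \<le> m"; cases "j \<le> m")
        assume "i \<le> m" "j \<le> m"
        then show ?thesis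
          using that spine[of i] spine[of j] hh[of i j] gg[of i j] hg[of i j] hg[of j i]
          unfolding e_def by (metis insertE singletonD)
      next
        assume "i \<le> m" "\<not> j \<le> m"
        then show ?thesis using that leg[of i] unfolding e_def disjoint_iff by metis
      next
        assume "\<not> i \<le> m" "j \<le> m"
        then show ?thesis using that leg[of j] unfolding e_def disjoint_iff by metis
      qed (use that in auto)
    qed
    have "inj_on z {1..m + 1}"
      using z disj by (intro inj_onI) metis
    moreover have "z ` {1..m + 1} \<subseteq> {N..<N + m}"
      using z by blast
    ultimately have "card {1..m + 1} \<le> card {N..<N + m}"
      by (intro card_inj_on_le) auto
    then show False by simp
  qed
qed

section \<open>Matchings and counting in bipartite relations\<close>

text \<open>
  The ends \<open>P\<close>, \<open>Q\<close> of a matching that cannot be extended meet all related pairs. This is weaker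
  than Koenig's theorem, which bounds \<open>card P + card Q\<close>, but easier; below, \<open>P\<close> and \<open>Q\<close> are used
  independently of each other.
\<close>

lemma matching_or_cover:
  fixes R :: "'a \<Rightarrow> 'b \<Rightarrow> bool"
  assumes "finite X" "finite Y"
  shows "(\<exists>M g. M \<subseteq> X \<and> card M = m \<and> inj_on g M \<and> g ` M \<subseteq> Y \<and> (\<forall>x \<in> M. R x (g x))) \<or>
     (\<exists>P Q. P \<subseteq> X \<and> Q \<subseteq> Y \<and> card P < m \<and> card Q < m \<and> (\<forall>x \<in> X - P. \<forall>y \<in> Y - Q. \<not> R x y))"
proof (induction m)
  case 0
  show ?case by (intro disjI1 exI[of _ "{}"]) simp
next
  case (Suc m)
  then show ?case
  proof (elim disjE exE conjE)
    fix M g assume M: "M \<subseteq> X" "card M = m" "inj_on g M" "g ` M \<subseteq> Y" "\<forall>x \<in> M. R x (g x)"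
    have fin: "finite M" using M(1) assms(1) finite_subset by blast
    show ?thesis
    proof (cases "\<exists>x \<in> X - M. \<exists>y \<in> Y - g ` M. R x y")
      case True
      then obtain x y where xy: "x \<in> X - M" "y \<in> Y - g ` M" "R x y" by blast
      have eq: "(g(x := y)) ` insert x M = insert y (g ` M)"
        using xy(1) by auto
      have "inj_on (g(x := y)) (insert x M)"
        using xy M(3) by (auto simp: inj_on_def)
      moreover have "(g(x := y)) ` insert x M \<subseteq> Y"
        unfolding eq using xy(2) M(4) by simp
      moreover have "insert x M \<subseteq> X" "card (insert x M) = Suc m"
        using xy(1) M(1,2) fin by auto
      moreover have "\<forall>z \<in> insert x M. R z ((g(x := y)) z)"
        using xy(3) M(5) by simp
      ultimately show ?thesis by blast
    next
      case False
      then show ?thesis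
        using M card_image[OF M(3)]
        by (intro disjI2 exI[of _ M] exI[of _ "g ` M"]) auto
    qed
  next
    fix P Q assume "P \<subseteq> X" "Q \<subseteq> Y" "card P < m" "card Q < m"
      "\<forall>x \<in> X - P. \<forall>y \<in> Y - Q. \<not> R x y"
    then show ?thesis
      by (intro disjI2 exI[of _ P] exI[of _ Q]) auto
  qed
qed

lemma greedy_matching:
  fixes R :: "'a \<Rightarrow> 'b \<Rightarrow> bool"
  assumes "finite A" "finite B" "\<And>a. a \<in> A \<Longrightarrow> card A \<le> card {b \<in> B. R a b}"
  shows "\<exists>g. inj_on g A \<and> g ` A \<subseteq> B \<and> (\<forall>a \<in> A. R a (g a))"
  using assms(1,3)
proof (induction A rule: finite_induct)
  case empty
  show ?case by simp
next
  case (insert a A)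
  have "card A \<le> card {b \<in> B. R x b}" if "x \<in> A" for x
    using insert.prems[of x] insert.hyps that by simp
  then obtain g where g: "inj_on g A" "g ` A \<subseteq> B" "\<forall>x \<in> A. R x (g x)"
    using insert.IH by blast
  have "card (g ` A) < card {b \<in> B. R a b}"
    using insert.prems[of a] insert.hyps card_image_le[of A g] by simp
  then have "\<not> {b \<in> B. R a b} \<subseteq> g ` A"
    using insert.hyps(1) by (meson card_mono finite_imageI not_less)
  then obtain b where b: "b \<in> B" "R a b" "b \<notin> g ` A" by blast
  have eq: "(g(a := b)) ` insert a A = insert b (g ` A)"
    using insert.hyps(2) by auto
  have "inj_on (g(a := b)) (insert a A)"
    using g(1) b(3) insert.hyps(2) by (auto simp: inj_on_def)
  moreover have "(g(a := b)) ` insert a A \<subseteq> B"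
    unfolding eq using g(2) b(1) by simp
  moreover have "\<forall>x \<in> insert a A. R x ((g(a := b)) x)"
    using g(3) b(2) by simp
  ultimately show ?case by blast
qed

text \<open>
  Count the related pairs of \<open>T\<close> and \<open>Y\<close>. A point of \<open>Y\<close> is in at most \<open>m\<close> of them, unless it is
  rich, that is, related to more than \<open>m\<close> points of \<open>T\<close>, and then it is in at most
  \<open>card T - m\<close> more. Every rich point is related to some \<open>x \<in> T\<close>,
  so there are at most \<open>b * card T\<close> rich points.
\<close>

lemma double_counting_bound:
  fixes R :: "'a \<Rightarrow> 'b \<Rightarrow> bool"
  assumes "finite T" "finite Y" "m \<le> card T"
    and deg: "\<And>x. x \<in> T \<Longrightarrow> n \<le> card {y \<in> Y. R x y}"
    and rich: "\<And>x. x \<in> T \<Longrightarrow> card {y \<in> Y. R x y \<and> m < card {z \<in> T. R z y}} \<le> b"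
  shows "n * card T \<le> m * card Y + (card T - m) * (b * card T)"
proof -
  define d where "d y = card {z \<in> T. R z y}" for y
  define B where "B = {y \<in> Y. m < d y}"
  have d: "d y \<le> card T" for y
    unfolding d_def using assms(1) by (intro card_mono) auto
  have "B \<subseteq> (\<Union>x \<in> T. {y \<in> Y. R x y \<and> m < card {z \<in> T. R z y}})"
  proof
    fix y assume y: "y \<in> B"
    then have "{z \<in> T. R z y} \<noteq> {}"
      unfolding B_def d_def by (metis (mono_tags, lifting) card.empty mem_Collect_eq not_less0)
    then show "y \<in> (\<Union>x \<in> T. {y \<in> Y. R x y \<and> m < card {z \<in> T. R z y}})"
      using y by (auto simp: B_def d_def)
  qed
  then have "card B \<le> card (\<Union>x \<in> T. {y \<in> Y. R x y \<and> m < card {z \<in> T. R z y}})"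
    using assms(1,2) by (intro card_mono) auto
  also have "\<dots> \<le> (\<Sum>x \<in> T. card {y \<in> Y. R x y \<and> m < card {z \<in> T. R z y}})"
    by (rule card_UN_le[OF assms(1)])
  also have "\<dots> \<le> (\<Sum>x \<in> T. b)"
    by (rule sum_mono) (rule rich)
  finally have B: "card B \<le> b * card T" by (simp add: mult.commute)
  have "n * card T = (\<Sum>x \<in> T. n)" by simp
  also have "\<dots> \<le> (\<Sum>x \<in> T. card {y \<in> Y. R x y})"
    by (rule sum_mono) (rule deg)
  also have "\<dots> = (\<Sum>y \<in> Y. d y)"
    unfolding d_def using assms(1,2) sum_multicount_gen[of T Y R d]
    by (simp add: d_def)
  also have "\<dots> \<le> (\<Sum>y \<in> Y. m + (if m < d y then card T - m else 0))"
    using d assms(3) by (intro sum_mono) (auto simp: add.commute)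
  also have "\<dots> = m * card Y + (card T - m) * card B"
    using assms(2) by (simp add: sum.distrib sum.If_cases B_def Int_def mult.commute)
  also have "\<dots> \<le> m * card Y + (card T - m) * (b * card T)"
    using B by simp
  finally show ?thesis .
qed

lemma pigeonhole_card_gt:
  assumes "f \<in> A \<rightarrow> C" "finite A" "finite C" "card C * s < card A"
  shows "\<exists>c \<in> C. s < card {a \<in> A. f a = c}"
proof -
  have "A \<noteq> {}" using assms(4) by auto
  then have "C \<noteq> {}" using assms(1) by auto
  from pigeonhole_card[OF assms(1-3) this]
  obtain c where c: "c \<in> C" "card A \<le> card (f -` {c} \<inter> A) * card C" by blast
  moreover have "f -` {c} \<inter> A = {a \<in> A. f a = c}" by auto
  ultimately have "card A \<le> card C * card {a \<in> A. f a = c}"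
    by (simp add: mult.commute)
  with assms(4) have "card C * s < card C * card {a \<in> A. f a = c}"
    by (rule less_le_trans)
  then have "s < card {a \<in> A. f a = c}"
    by (simp only: mult_less_cancel1)
  then show ?thesis using c(1) by blast
qed

section \<open>The upper bound and the Ramsey number\<close>

text \<open>
  The bound \<open>(k - 1) * (t - 1) < n - m + 1\<close> says that \<open>n - m + 1\<close> vertices with \<open>k - 1\<close> colours
  include \<open>t\<close> vertices of the same colour; the last hypothesis is the failure of the double count
  for such \<open>t\<close> vertices.
\<close>

lemma ramsey_arrows_subdivided_star:
  fixes k n m t :: nat
  assumes k: "k \<ge> 1" and mn: "1 \<le> m" "m \<le> n" and t: "m \<le> t" "(k - 1) * (t - 1) < n - m + 1"
    and ineq: "(t - m) * ((m - 1) * t) + m * ((k - 1) * (n - 1) + m) < n * t"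
  shows "ramsey_arrows (k * (n - 1) + m + 2) (subdivided_star n m) k"
  unfolding ramsey_arrows_def
proof (intro allI impI)
  define N where "N = k * (n - 1) + m + 2"
  fix \<tau> assume "edge_coloring k (complete_graph (k * (n - 1) + m + 2)) \<tau>"
  then have "\<tau> e \<in> {1..k}" if "e \<in> edges (complete_graph N)" for e
    using that unfolding edge_coloring_def N_def by blast
  then have \<tau>: "\<tau> {u, w} \<in> {1..k}" if "u < N" "w < N" "u \<noteq> w" for u w
    using that edges_complete_graph by blast
  have edgeI: "{u, w} \<in> edges (color_class (complete_graph N) \<tau> c)"
    if "u < N" "w < N" "u \<noteq> w" "\<tau> {u, w} = c" for u w c
    using that by (simp add: edges_color_class edges_complete_graph)
  have "\<exists>c \<in> {1..k}. contains_copy (color_class (complete_graph N) \<tau> c) (subdivided_star n m)"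
  proof (rule ccontr)
    assume "\<not> ?thesis"
    then have no: "\<not> contains_copy (color_class (complete_graph N) \<tau> c) (subdivided_star n m)"
      if "c \<in> {1..k}" for c
      using that by blast

    \<comment> \<open>Any vertex could serve as the first centre; here it is \<open>0\<close>.\<close>
    have "\<exists>c \<in> {1..k}. n - 1 < card {w \<in> {1..<N}. \<tau> {0, w} = c}"
    proof (rule pigeonhole_card_gt)
      show "(\<lambda>w. \<tau> {0, w}) \<in> {1..<N} \<rightarrow> {1..k}"
        using \<tau>[of 0] by auto
    qed (use mn in \<open>auto simp: N_def\<close>)
    then obtain c where c: "c \<in> {1..k}" and cn: "n \<le> card {w \<in> {1..<N}. \<tau> {0, w} = c}"
      by fastforce
    obtain X where X: "X \<subseteq> {w \<in> {1..<N}. \<tau> {0, w} = c}" "card X = n" "finite X"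
      by (rule obtain_subset_with_card_n[OF cn])
    define Y where "Y = {1..<N} - X"
    have Xsub: "X \<subseteq> {1..<N}" using X(1) by blast
    have finY: "finite Y" by (simp add: Y_def)
    have cardY: "card Y = (k - 1) * (n - 1) + m"
    proof -
      have "card Y = N - 1 - n"
        using X Xsub by (simp add: Y_def card_Diff_subset)
      moreover have "k * (n - 1) = (k - 1) * (n - 1) + (n - 1)"
        using k by (cases k) auto
      ultimately show ?thesis using mn by (simp add: N_def)
    qed
    have XN: "x < N" "x \<noteq> 0" if "x \<in> X" for x using that Xsub by auto
    have YN: "y < N" "y \<notin> X" if "y \<in> Y" for y using that by (auto simp: Y_def)

    \<comment> \<open>A matching of size \<open>m\<close> from \<open>X\<close> to \<open>Y\<close> would complete a copy with centre \<open>0\<close>. That \<open>Y\<close> may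
      contain further \<open>c\<close>-neighbours of \<open>0\<close> does no harm.\<close>
    from matching_or_cover[OF X(3) finY, of m "\<lambda>x y. \<tau> {x, y} = c"]
    obtain P Q where PQ: "P \<subseteq> X" "Q \<subseteq> Y" "card P < m" "card Q < m"
      and cover: "\<And>x y. x \<in> X - P \<Longrightarrow> y \<in> Y - Q \<Longrightarrow> \<tau> {x, y} \<noteq> c"
    proof (elim disjE exE conjE, goal_cases)
      case (1 M g)
      have "contains_copy (color_class (complete_graph N) \<tau> c) (subdivided_star n m)"
      proof (rule contains_copy_subdivided_starI[where v = 0 and X = X and M = M and g = g])
        show "{0, x} \<in> edges (color_class (complete_graph N) \<tau> c)" if "x \<in> X" for x
          using that X(1) XN[OF that] by (intro edgeI) auto
        show "{x, g x} \<in> edges (color_class (complete_graph N) \<tau> c)" if "x \<in> M" for x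
        proof (rule edgeI)
          have "x \<in> X" "g x \<in> Y" using that 1 by auto
          then show "x < N" "g x < N" "x \<noteq> g x" using XN YN by auto
          show "\<tau> {x, g x} = c" using that 1 by blast
        qed
        show "g ` M \<inter> X = {}" using 1(5) YN by blast
        show "g ` M \<subseteq> verts (color_class (complete_graph N) \<tau> c)" using 1(5) YN by auto
        show "0 \<notin> X" using XN(2) by blast
        show "0 \<notin> g ` M" using 1(5) by (auto simp: Y_def)
      qed (use 1 X(2,3) XN mn in \<open>auto simp: N_def\<close>)
      then show ?case using no[OF c] by blast
    next
      case (2 P Q)
      then show ?case by blast
    qed

    have "\<exists>d \<in> {1..k} - {c}. n - 1 < card {y \<in> Y - Q. \<tau> {x, y} = d}" if x: "x \<in> X - P" for x
    proof (rule pigeonhole_card_gt)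
      show "(\<lambda>y. \<tau> {x, y}) \<in> Y - Q \<rightarrow> {1..k} - {c}"
      proof
        fix y assume y: "y \<in> Y - Q"
        then have "\<tau> {x, y} \<in> {1..k}"
          using x XN[of x] YN[of y] by (intro \<tau>) auto
        then show "\<tau> {x, y} \<in> {1..k} - {c}" using cover[OF x y] by simp
      qed
      have "card (Y - Q) = card Y - card Q"
        using PQ(2) finY finite_subset by (blast intro: card_Diff_subset)
      moreover have "a < a + m - card Q" for a
        using PQ(4) by simp
      ultimately show "card ({1..k} - {c}) * (n - 1) < card (Y - Q)"
        using c cardY by simp
    qed (use finY in auto)
    then obtain \<kappa> where \<kappa>: "\<And>x. x \<in> X - P \<Longrightarrow>
        \<kappa> x \<in> {1..k} - {c} \<and> n - 1 < card {y \<in> Y - Q. \<tau> {x, y} = \<kappa> x}"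
      by metis

    have "\<exists>d \<in> {1..k} - {c}. t - 1 < card {x \<in> X - P. \<kappa> x = d}"
    proof (rule pigeonhole_card_gt)
      show "\<kappa> \<in> X - P \<rightarrow> {1..k} - {c}" using \<kappa> by blast
      have "card (X - P) = card X - card P"
        using PQ(1) X(3) finite_subset by (blast intro: card_Diff_subset)
      then have "n - m + 1 \<le> card (X - P)"
        using PQ(3) X(2) mn by simp
      moreover have "card ({1..k} - {c}) = k - 1" using c by simp
      ultimately show "card ({1..k} - {c}) * (t - 1) < card (X - P)"
        using t(2) by (metis less_le_trans)
    qed (use X(3) in auto)
    then obtain d where d: "d \<in> {1..k}" and ct: "t \<le> card {x \<in> X - P. \<kappa> x = d}"
      by fastforce
    obtain T where T: "T \<subseteq> {x \<in> X - P. \<kappa> x = d}" "card T = t" "finite T"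
      by (rule obtain_subset_with_card_n[OF ct])
    have TX: "T \<subseteq> X" using T(1) by blast
    have deg: "n \<le> card {y \<in> Y. \<tau> {x, y} = d}" if "x \<in> T" for x
    proof -
      have "n - 1 < card {y \<in> Y - Q. \<tau> {x, y} = d}" using that T(1) \<kappa>[of x] by auto
      also have "\<dots> \<le> card {y \<in> Y. \<tau> {x, y} = d}" using finY by (intro card_mono) auto
      finally show ?thesis by simp
    qed

    \<comment> \<open>Otherwise \<open>m\<close> neighbours of \<open>x\<close> with more than \<open>m\<close> neighbours in \<open>T\<close> have pairwise
      distinct partners in \<open>T - {x}\<close>. These partners lie in \<open>X\<close>, hence outside \<open>Y\<close>, and so they avoid the neighbours of \<open>x\<close> that the copy uses.\<close>
    have "card {y \<in> Y. \<tau> {x, y} = d \<and> m < card {z \<in> T. \<tau> {z, y} = d}} \<le> m - 1" if x: "x \<in> T" for x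
    proof (rule ccontr)
      assume "\<not> ?thesis"
      then have "m \<le> card {y \<in> Y. \<tau> {x, y} = d \<and> m < card {z \<in> T. \<tau> {z, y} = d}}" by simp
      then obtain A where A: "A \<subseteq> {y \<in> Y. \<tau> {x, y} = d \<and> m < card {z \<in> T. \<tau> {z, y} = d}}"
        "card A = m" "finite A"
        by (rule obtain_subset_with_card_n)
      have "card A \<le> card {z \<in> T - {x}. \<tau> {z, y} = d}" if "y \<in> A" for y
      proof -
        have "m < card {z \<in> T. \<tau> {z, y} = d}" using that A(1) by blast
        moreover have "card {z \<in> T. \<tau> {z, y} = d} - card {x}
            \<le> card ({z \<in> T. \<tau> {z, y} = d} - {x})"
          by (rule diff_card_le_card_Diff) simp
        ultimately have "card A \<le> card ({z \<in> T. \<tau> {z, y} = d} - {x})"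
          using A(2) by simp
        also have "{z \<in> T. \<tau> {z, y} = d} - {x} = {z \<in> T - {x}. \<tau> {z, y} = d}" by blast
        finally show ?thesis .
      qed
      then obtain g where g: "inj_on g A" "g ` A \<subseteq> T - {x}" "\<forall>y \<in> A. \<tau> {g y, y} = d"
        using greedy_matching[of A "T - {x}" "\<lambda>y z. \<tau> {z, y} = d"] A(3) T(3) by auto
      have "contains_copy (color_class (complete_graph N) \<tau> d) (subdivided_star n m)"
      proof (rule contains_copy_subdivided_starI[where v = x and X = "{y \<in> Y. \<tau> {x, y} = d}"
            and M = A and g = g])
        have xX: "x \<in> X" using x TX by blast
        show "x \<in> verts (color_class (complete_graph N) \<tau> d)" using XN(1)[OF xX] by simp
        show "{y \<in> Y. \<tau> {x, y} = d} \<subseteq> verts (color_class (complete_graph N) \<tau> d)"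
          using YN by auto
        show "x \<notin> {y \<in> Y. \<tau> {x, y} = d}" using xX YN by blast
        show "{x, y} \<in> edges (color_class (complete_graph N) \<tau> d)"
          if "y \<in> {y \<in> Y. \<tau> {x, y} = d}" for y
          using that XN[OF xX] YN[of y] xX by (intro edgeI) auto
        show "{y, g y} \<in> edges (color_class (complete_graph N) \<tau> d)" if "y \<in> A" for y
        proof (rule edgeI)
          have "y \<in> Y" "g y \<in> X" using that A(1) g(2) TX by auto
          then show "y < N" "g y < N" "y \<noteq> g y" using XN YN by auto
          show "\<tau> {y, g y} = d" using that g(3) by (simp add: insert_commute)
        qed
        show "g ` A \<inter> {y \<in> Y. \<tau> {x, y} = d} = {}" using g(2) TX YN by blast
        show "g ` A \<subseteq> verts (color_class (complete_graph N) \<tau> d)" using g(2) TX XN by auto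
        show "x \<notin> g ` A" using g(2) by blast
        show "n \<le> card {y \<in> Y. \<tau> {x, y} = d}" by (rule deg[OF x])
      qed (use A g mn finY in auto)
      then show False using no[OF d] by blast
    qed
    then have "n * card T \<le> m * card Y + (card T - m) * ((m - 1) * card T)"
      using double_counting_bound[OF T(3) finY, of m n "\<lambda>x y. \<tau> {x, y} = d" "m - 1"] deg t(1) T(2)
      by blast
    then show False using ineq cardY T(2) by simp
  qed
  then show "\<exists>c \<in> {1..k}. contains_copy
      (color_class (complete_graph (k * (n - 1) + m + 2)) \<tau> c) (subdivided_star n m)"
    unfolding N_def .
qed

lemma less_ramsey_number:
  assumes "ramsey_arrows N H k" "\<not> ramsey_arrows N' H k"
  shows "N' < ramsey_number H k"
proof (rule ccontr)
  assume "\<not> N' < ramsey_number H k"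
  moreover have "ramsey_arrows (ramsey_number H k) H k"
    unfolding ramsey_number_def using assms(1) by (rule LeastI)
  ultimately show False
    using ramsey_arrows_mono assms(2) by (metis not_less)
qed

theorem theorem1p7:
  fixes k n m :: nat and t :: int
  assumes "k \<ge> 2" and "n \<ge> 2" and "n \<ge> m" and "m \<ge> 1"
    and "t = \<lceil>(real n - real m + 1) / (real k - 1)\<rceil>"
    and "t > int m"
    and "int n * t > (t - int m) * (int m - 1) * t
           + int m * ((int n - 1) * (int k - 1) + int m)"
  shows "(odd k \<longrightarrow> ramsey_number (subdivided_star n m) k = k * (n - 1) + m + 2)
    \<and> (even k \<longrightarrow>
         max (k * (n - 1) + 1) ((k - 1) * (n - 1) + 2 * m + 2)
           \<le> ramsey_number (subdivided_star n m) k
         \<and> ramsey_number (subdivided_star n m) k \<le> k * (n - 1) + m + 2)"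
proof -
  define s where "s = nat t"
  have t: "t = int s" using assms(6) by (simp add: s_def)
  have ms: "m < s" using assms(6) t by simp
  have "real_of_int t - 1 < (real n - real m + 1) / (real k - 1)"
    unfolding assms(5) by linarith
  then have "(real s - 1) * (real k - 1) < real n - real m + 1"
    using assms(1) by (simp add: t field_simps)
  also have "(real s - 1) * (real k - 1) = real ((k - 1) * (s - 1))"
    using assms(1) ms by (simp add: of_nat_diff)
  also have "real n - real m + 1 = real (n - m + 1)"
    using assms(3) by (simp add: of_nat_diff)
  finally have s: "(k - 1) * (s - 1) < n - m + 1"
    by (simp only: of_nat_less_iff)
  have "1 * m \<le> (k - 1) * (s - 1)"
    using assms(1) ms by (intro mult_le_mono) auto
  with s assms(3,4) have mn: "m < n" by linarith

  have diffs: "t - int m = int (s - m)" "int m - 1 = int (m - 1)"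
    "int n - 1 = int (n - 1)" "int k - 1 = int (k - 1)"
    using assms(1,2,4) ms t by auto
  have "int ((s - m) * ((m - 1) * s) + m * ((k - 1) * (n - 1) + m)) < int (n * s)"
    using assms(7) unfolding diffs unfolding t
    by (simp del: of_nat_diff add: ac_simps)
  then have "(s - m) * ((m - 1) * s) + m * ((k - 1) * (n - 1) + m) < n * s"
    by (simp only: of_nat_less_iff)
  then have arr: "ramsey_arrows (k * (n - 1) + m + 2) (subdivided_star n m) k"
    using assms(1,3,4) ms s by (intro ramsey_arrows_subdivided_star[of k m n s]) auto
  then have upper: "ramsey_number (subdivided_star n m) k \<le> k * (n - 1) + m + 2"
    unfolding ramsey_number_def by (rule Least_le)
  have "k * (n - 1) + m + 1 < ramsey_number (subdivided_star n m) k" if "odd k"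
    using that assms(2,3) by (intro less_ramsey_number[OF arr] not_ramsey_arrows_odd) auto
  moreover have "k * (n - 1) < ramsey_number (subdivided_star n m) k"
    using assms(1,2,3) by (intro less_ramsey_number[OF arr] not_ramsey_arrows_regular) auto
  moreover have "(k - 1) * (n - 1) + 2 * m + 1 < ramsey_number (subdivided_star n m) k" if "even k"
  proof -
    have "odd (k - 1)" using that assms(1) by simp
    then have "\<not> ramsey_arrows ((k - 1) * (n - 1) + m + 1) (subdivided_star n m) (k - 1)"
      using assms(2,3) by (intro not_ramsey_arrows_odd) auto
    from not_ramsey_arrows_Suc_color[OF this mn]
    have "\<not> ramsey_arrows ((k - 1) * (n - 1) + 2 * m + 1) (subdivided_star n m) k"
      using assms(1) by (simp add: mult_2 add.assoc add.left_commute add.commute)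
    then show ?thesis by (rule less_ramsey_number[OF arr])
  qed
  ultimately show ?thesis using upper by auto
qed

end
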